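(* There exist real numbers $p_A,p_B,r_0,r_1,s_0,s_1$ and complex numbers $\alpha_i,\beta_i,\gamma_j,\delta_j$ ($i,j\in\{0,1\}$) with $|\alpha_i|^2+|\beta_i|^2=|\gamma_j|^2+|\delta_j|^2=1$ such that (1) $|r_i|\le \tfrac12$ and $|s_j|\le\tfrac12$ for all $i,j\in\{0,1\}$, and $|p_A|\le\tfrac12$, $|p_B|\le\tfrac12$; (2) $0\le p^{(ij)}_{mn}\le 1$ for all $i,j\in\{0,1\}$ and all $m,n\in\{0,1,\bullet\}$; (3) the winning probability $$p_{win}=\frac14\Big[\sum_{(i,j)\in\{(0,0),(0,1),(1,0)\}}\big(p^{(ij)}_{00}+p^{(ij)}_{11}+p^{(ij)}_{1\bullet}+p^{(ij)}_{\bullet1}+p^{(ij)}_{\bullet\bullet}\big)+p^{(11)}_{01}+p^{(11)}_{10}+p^{(11)}_{0\bullet}+p^{(11)}_{\bullet0}\Big]$$ satisfies $p_{win}\simeq 0.8647$, i.e. $|p_{win}-0.8647|\le 5\cdot10^{-5}$; in particular $p_{win}>\cos^2(\pi/8)$ (Tsirelson's bound). Here the numbers $p^{(ij)}_{mn}$ are the measurement probabilities (obtained with the modified Rogers norm) of the state $\Upsilon_{AB}(p_A,p_B)$ after the local superunitary rotation $Z_{iA}\otimes Z_{jB}$, as defined in the context.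
   Context: Grassmann algebra. $\Lambda$ is the complex Grassmann algebra of order 4 with anticommuting generators $\eta_A,\eta_A^\#,\eta_B,\eta_B^\#$, graded by parity $|\cdot|\in\{0,1\}$. The map $\#:\Lambda\to\Lambda$ is additive, $(a\xi)^\#=\bar a\,\xi^\#$ for $a\in\mathbb C$, multiplicative in the order-preserving sense $(\xi\zeta)^\#=\xi^\#\zeta^\#$, and sends $\eta_X\mapsto\eta_X^\#$, $\eta_X^\#\mapsto-\eta_X$ for $X=A,B$. Modified Rogers norm. For even $\tau\in\Lambda$, $|\tau|_R=\int d\eta_A\,d\eta_A^\#\,d\eta_B\,d\eta_B^\#\;e^{-\eta_A\eta_A^\#}e^{-\eta_B\eta_B^\#}\,\tau$ is the Berezin integral with $\int d\eta_X d\eta_X^\#(-\eta_X\eta_X^\#)=1$. Explicitly, $|\cdot|_R$ is the $\mathbb C$-linear functional on even elements with $|1|_R=1$, $|\eta_A\eta_A^\#|_R=|\eta_B\eta_B^\#|_R=-1$, $|\eta_A\eta_A^\#\eta_B\eta_B^\#|_R=1$, and value $0$ on $\eta_A\eta_B$, $\eta_A\eta_B^\#$, $\eta_A^\#\eta_B$, $\eta_A^\#\eta_B^\#$. States. Each party has the basis $|0\rangle,|1\rangle$ (even, $|0|=|1|=0$) and $|\bullet\rangle$ (odd, $|\bullet|=1$). Two-party states are combinations $\sum_{m,n}c_{mn}|mn\rangle$, where $|mn\rangle=|m\rangle_A|n\rangle_B$, with coefficients $c_{mn}\in\Lambda$ written on the left. Odd elements of $\Lambda$ anticommute with $|\bullet\rangle$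 and commute with $|0\rangle,|1\rangle$; even elements of $\Lambda$ commute with everything. The state is $$\Upsilon_{AB}(p_A,p_B)=\Big(1+\tfrac{p_A^2}{2}\eta_A\eta_A^\#\Big)\Big(1+\tfrac{p_B^2}{2}\eta_B\eta_B^\#\Big)\tfrac{1}{\sqrt2}(|00\rangle+|11\rangle)+p_B\eta_B\Big(1+\tfrac{p_A^2}{2}\eta_A\eta_A^\#\Big)|1\bullet\rangle+p_A\eta_A\Big(1+\tfrac{p_B^2}{2}\eta_B\eta_B^\#\Big)|\bullet1\rangle-p_Ap_B\eta_A\eta_B|\bullet\bullet\rangle .$$ Rotations. $Z_{iA}=S(2r_i\eta_A)U(\alpha_i,\beta_i)$ acts on the first factor and $Z_{jB}=S(2s_j\eta_B)U(\gamma_j,\delta_j)$ on the second. Here $U(\alpha,\beta)|0\rangle=\alpha|0\rangle+\beta|1\rangle$, $U(\alpha,\beta)|1\rangle=-\bar\beta|0\rangle+\bar\alpha|1\rangle$, $U(\alpha,\beta)|\bullet\rangle=|\bullet\rangle$. For real $p$ and $\eta=\eta_A$ or $\eta_B$, $S(2p\eta)$ is the even supermatrix (in the ordered basis $|0\rangle,|1\rangle,|\bullet\rangle$) $$S(2p\eta)=\begin{pmatrix} 1+\frac{p^2}{2}\eta\eta^\# & 0 & -p\eta^\# \\ 0 & 1+\frac{p^2}{2}\eta\eta^\# & -p\eta \\ {p}\eta & -p\eta^\# & 1-p^2\eta\eta^\# \end{pmatrix}$$ acting on columns of right coordinates. With coefficients on the left this reads $S|0\rangle=(1+\frac{p^2}{2}\eta\eta^\#)|0\rangle-p\eta|\bullet\rangle$,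 $S|1\rangle=(1+\frac{p^2}{2}\eta\eta^\#)|1\rangle+p\eta^\#|\bullet\rangle$, $S|\bullet\rangle=-p\eta^\#|0\rangle-p\eta|1\rangle+(1-p^2\eta\eta^\#)|\bullet\rangle$. Since $S,U$ are even they commute with multiplication by elements of $\Lambda$, and $(Z_{iA}\otimes Z_{jB})(|m\rangle_A|n\rangle_B)=(Z_{iA}|m\rangle_A)(Z_{jB}|n\rangle_B)$ (expand and move all coefficients to the left using the sign rules above). Probabilities. Write $(Z_{iA}\otimes Z_{jB})\Upsilon_{AB}(p_A,p_B)=\sum_{m,n}c^{(ij)}_{mn}|mn\rangle$. The Grassmann-valued probability is $p^{(ij)}_{\mathcal G mn}=(-1)^{|m|+|n|}\langle m_An_B|\Upsilon_{iA,jB}\rangle\langle\Upsilon_{iA,jB}|n_Bm_A\rangle$, which in terms of coefficients equals $(-1)^{|m|+|n|+|m||n|}\,c^{(ij)}_{mn}\,(c^{(ij)}_{mn})^\#$; these sum to $1$ over $m,n$. Finally $p^{(ij)}_{mn}=|p^{(ij)}_{\mathcal G mn}|_R\in\mathbb R$. CHSH game: on input bits $(i,j)$ (uniform), Alice and Bob win if their output bits satisfy $ij=a\oplus b$; outcomes $1$ and $\bullet$ are both reported as bit $1$ and outcome $0$ as bit $0$. The maximal quantum winning probability is $\cos^2(\pi/8)\approx0.8536$. *)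

theory Defs
  imports Complex_Main
begin

datatype party = Alice | Bob

datatype gen = Eta party | EtaS party

lemma UNIV_gen: "(UNIV :: gen set) = {Eta Alice, EtaS Alice, Eta Bob, EtaS Bob}"
  by (auto, metis gen.exhaust party.exhaust)

instance gen :: finite
  by standard (simp add: UNIV_gen)

text \<open>The generators are ordered as
  \<open>\<eta>\<^sub>A < \<eta>\<^sub>A\<^sup># < \<eta>\<^sub>B < \<eta>\<^sub>B\<^sup>#\<close>.\<close>

fun gen_index :: "gen \<Rightarrow> nat" where
  "gen_index (Eta Alice) = 0"
| "gen_index (EtaS Alice) = 1"
| "gen_index (Eta Bob) = 2"
| "gen_index (EtaS Bob) = 3"

lemma gen_index_inject: "gen_index g = gen_index h \<longleftrightarrow> g = h"
  by (cases g rule: gen_index.cases; cases h rule: gen_index.cases) auto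

instantiation gen :: linorder
begin
definition "g \<le> h \<longleftrightarrow> gen_index g \<le> gen_index h"
definition "g < h \<longleftrightarrow> gen_index g < gen_index h"
instance
  by standard (auto simp: less_eq_gen_def less_gen_def gen_index_inject)
end

text \<open>\<open>coeff x S\<close> is the coefficient of \<open>x\<close> at the monomial that multiplies the
  generators in \<open>S\<close> in increasing order.\<close>

datatype grassmann = Grassmann (coeff: "gen set \<Rightarrow> complex")

lemma grassmann_eqI: "(\<And>S. coeff x S = coeff y S) \<Longrightarrow> x = y"
  by (cases x; cases y) auto

text \<open>The sign from sorting the concatenation of the monomials of disjoint \<open>S\<close> and \<open>T\<close>.\<close>

definition gsign :: "gen set \<Rightarrow> gen set \<Rightarrow> complex" where
  "gsign S T = (\<Prod>i\<in>S. \<Prod>j\<in>T. if j < i then -1 else 1)"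

lemma gsign_empty [simp]: "gsign {} T = 1" "gsign S {} = 1"
  by (simp_all add: gsign_def)

lemma gsign_Un_left: "S \<inter> T = {} \<Longrightarrow> gsign (S \<union> T) V = gsign S V * gsign T V"
  by (simp add: gsign_def prod.union_disjoint)

lemma gsign_Un_right: "S \<inter> T = {} \<Longrightarrow> gsign V (S \<union> T) = gsign V S * gsign V T"
  by (simp add: gsign_def prod.union_disjoint prod.distrib)

instantiation grassmann :: ring_1
begin

definition "0 = Grassmann (\<lambda>S. 0)"
definition "1 = Grassmann (\<lambda>S. if S = {} then 1 else 0)"
definition "x + y = Grassmann (\<lambda>S. coeff x S + coeff y S)"
definition "- x = Grassmann (\<lambda>S. - coeff x S)"
definition "x - y = Grassmann (\<lambda>S. coeff x S - coeff y S)"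
definition "x * y =
  Grassmann (\<lambda>S. \<Sum>T\<in>Pow S. gsign T (S - T) * coeff x T * coeff y (S - T))"

lemma coeff_simps [simp]:
  "coeff 0 S = 0"
  "coeff 1 S = (if S = {} then 1 else 0)"
  "coeff (x + y) S = coeff x S + coeff y S"
  "coeff (- x) S = - coeff x S"
  "coeff (x - y) S = coeff x S - coeff y S"
  by (simp_all add: zero_grassmann_def one_grassmann_def plus_grassmann_def
      uminus_grassmann_def minus_grassmann_def)

lemma coeff_mult:
  "coeff (x * y) S = (\<Sum>T\<in>Pow S. gsign T (S - T) * coeff x T * coeff y (S - T))"
  by (simp add: times_grassmann_def)

instance
proof
  fix x y z :: grassmann
  show "x * y * z = x * (y * z)"
  proof (rule grassmann_eqI)
    fix S
    let ?f = "\<lambda>T V W. coeff x T * coeff y V * coeff z W"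
    have "coeff (x * y * z) S =
        (\<Sum>(W, T)\<in>Sigma (Pow S) Pow.
          gsign W (S - W) * gsign T (W - T) * ?f T (W - T) (S - W))"
      by (simp add: coeff_mult sum_distrib_left sum_distrib_right mult_ac sum.Sigma)
    also have "\<dots> = (\<Sum>(T, V)\<in>Sigma (Pow S) (\<lambda>T. Pow (S - T)).
          gsign T (S - T) * gsign V (S - T - V) * ?f T V (S - T - V))"
    proof (rule sum.reindex_bij_witness
        [where i = "\<lambda>(T, V). (T \<union> V, T)" and j = "\<lambda>(W, T). (T, W - T)"])
      fix p assume "p \<in> Sigma (Pow S) Pow"
      then obtain W T where p: "p = (W, T)" and WT: "W \<subseteq> S" "T \<subseteq> W"
        by auto
      have e: "S - T - (W - T) = S - W" "W = T \<union> (W - T)" "S - T = (W - T) \<union> (S - W)"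
        using WT by auto
      have "gsign W (S - W) = gsign T (S - W) * gsign (W - T) (S - W)"
        using gsign_Un_left [of T "W - T" "S - W"] e(2) by auto
      moreover have "gsign T (S - T) = gsign T (W - T) * gsign T (S - W)"
        using gsign_Un_right [of "W - T" "S - W" T] e(3) by auto
      ultimately show "(case (case p of (W, T) \<Rightarrow> (T, W - T)) of (T, V) \<Rightarrow>
            gsign T (S - T) * gsign V (S - T - V) * ?f T V (S - T - V)) =
          (case p of (W, T) \<Rightarrow>
            gsign W (S - W) * gsign T (W - T) * ?f T (W - T) (S - W))"
        by (simp add: p e(1))
    qed auto
    also have "\<dots> = coeff (x * (y * z)) S"
      by (simp add: coeff_mult sum_distrib_left sum_distrib_right mult_ac sum.Sigma)
    finally show "coeff (x * y * z) S = coeff (x * (y * z)) S" .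
  qed
  show "1 * x = x"
  proof (rule grassmann_eqI)
    fix S
    have "coeff (1 * x) S =
        (\<Sum>T\<in>Pow S. if T = {} then gsign T (S - T) * coeff x (S - T) else 0)"
      unfolding coeff_mult by (rule sum.cong) auto
    then show "coeff (1 * x) S = coeff x S"
      by simp
  qed
  show "x * 1 = x"
  proof (rule grassmann_eqI)
    fix S
    have "coeff (x * 1) S = (\<Sum>T\<in>Pow S. if T = S then gsign T (S - T) * coeff x T else 0)"
      unfolding coeff_mult by (rule sum.cong) auto
    then show "coeff (x * 1) S = coeff x S"
      by simp
  qed
  show "(x + y) * z = x * z + y * z" "x * (y + z) = x * y + x * z"
    by (rule grassmann_eqI, simp add: coeff_mult sum.distrib ring_distribs)+
  show "(0::grassmann) \<noteq> 1"
    by (metis coeff_simps(1,2) zero_neq_one)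
qed (rule grassmann_eqI, simp)+

end

definition cst :: "complex \<Rightarrow> grassmann" where
  "cst a = Grassmann (\<lambda>S. if S = {} then a else 0)"

abbreviation rcst :: "real \<Rightarrow> grassmann" where
  "rcst t \<equiv> cst (complex_of_real t)"

definition gmono :: "gen set \<Rightarrow> grassmann" where
  "gmono S = Grassmann (\<lambda>T. if T = S then 1 else 0)"

definition gvar :: "gen \<Rightarrow> grassmann" where
  "gvar g = gmono {g}"

abbreviation eta :: "party \<Rightarrow> grassmann" where
  "eta X \<equiv> gvar (Eta X)"

abbreviation etaS :: "party \<Rightarrow> grassmann" where
  "etaS X \<equiv> gvar (EtaS X)"

lemma coeff_cst [simp]: "coeff (cst a) S = (if S = {} then a else 0)"
  by (simp add: cst_def)

lemma coeff_gmono [simp]: "coeff (gmono S) T = (if T = S then 1 else 0)"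
  by (simp add: gmono_def)

lemma coeff_cst_mult [simp]: "coeff (cst a * x) S = a * coeff x S"
proof -
  have "coeff (cst a * x) S =
      (\<Sum>T\<in>Pow S. if T = {} then a * (gsign T (S - T) * coeff x (S - T)) else 0)"
    unfolding coeff_mult by (rule sum.cong) auto
  then show ?thesis
    by simp
qed

lemma coeff_mult_cst [simp]: "coeff (x * cst a) S = a * coeff x S"
proof -
  have "coeff (x * cst a) S =
      (\<Sum>T\<in>Pow S. if T = S then a * (gsign T (S - T) * coeff x T) else 0)"
    unfolding coeff_mult by (rule sum.cong) auto
  then show ?thesis
    by simp
qed

lemma gmono_mult:
  "gmono S * gmono T = (if S \<inter> T = {} then cst (gsign S T) * gmono (S \<union> T) else 0)"
proof (rule grassmann_eqI)
  fix W
  have "coeff (gmono S * gmono T) W =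
      (\<Sum>V\<in>Pow W. if V = S then (if W - S = T then gsign S T else 0) else 0)"
    unfolding coeff_mult by (rule sum.cong) auto
  also have "\<dots> = (if S \<subseteq> W \<and> W - S = T then gsign S T else 0)"
    by (simp add: sum.delta')
  also have "\<dots> = coeff (if S \<inter> T = {} then cst (gsign S T) * gmono (S \<union> T) else 0) W"
    by auto
  finally show "coeff (gmono S * gmono T) W =
      coeff (if S \<inter> T = {} then cst (gsign S T) * gmono (S \<union> T) else 0) W" .
qed

lemma gvar_anticommute: "gvar g * gvar h = - (gvar h * gvar g)"
  by (rule grassmann_eqI) (auto simp: gvar_def gmono_mult gsign_def insert_commute)

lemma gvar_square: "gvar g * gvar g = 0"
  by (simp add: gvar_def gmono_mult)

text \<open>Grade involution: \<open>x\<close> to \<open>(-1)\<^bsup>|x|\<^esup> x\<close> on homogeneous elements.\<close>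

definition ginvol :: "grassmann \<Rightarrow> grassmann" where
  "ginvol x = Grassmann (\<lambda>S. (-1) ^ card S * coeff x S)"

fun sharp_gen :: "gen \<Rightarrow> grassmann" where
  "sharp_gen (Eta X) = etaS X"
| "sharp_gen (EtaS X) = - eta X"

definition sharp :: "grassmann \<Rightarrow> grassmann" where
  "sharp x = (\<Sum>S\<in>UNIV. cst (cnj (coeff x S)) *
     prod_list (map sharp_gen (sorted_list_of_set S)))"

text \<open>The next lemmas confirm that \<open>sharp\<close> is the map determined by additivity,
  antilinearity, multiplicativity and its values on the generators.\<close>

lemma coeff_sum: "coeff (sum f I) S = (\<Sum>i\<in>I. coeff (f i) S)"
  by (induction I rule: infinite_finite_induct) auto

lemma sharp_add: "sharp (x + y) = sharp x + sharp y"
  by (rule grassmann_eqI) (simp add: sharp_def coeff_sum ring_distribs sum.distrib)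

lemma sharp_cst_mult: "sharp (cst a * x) = cst (cnj a) * sharp x"
  by (rule grassmann_eqI) (simp add: sharp_def coeff_sum sum_distrib_left mult_ac)

lemma sharp_gmono: "sharp (gmono S) = prod_list (map sharp_gen (sorted_list_of_set S))"
proof (rule grassmann_eqI)
  fix T
  let ?p = "\<lambda>S. prod_list (map sharp_gen (sorted_list_of_set S))"
  have "coeff (sharp (gmono S)) T = (\<Sum>V\<in>UNIV. if V = S then coeff (?p V) T else 0)"
    unfolding sharp_def coeff_sum by (rule sum.cong) auto
  then show "coeff (sharp (gmono S)) T = coeff (?p S) T"
    by simp
qed

lemma sharp_gvar: "sharp (gvar g) = sharp_gen g"
  by (simp add: gvar_def sharp_gmono)

fun swap_gen :: "gen \<Rightarrow> gen" where
  "swap_gen (Eta X) = EtaS X"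
| "swap_gen (EtaS X) = Eta X"

lemma swap_swap_gen [simp]: "swap_gen (swap_gen g) = g"
  by (cases g) auto

lemma inj_swap_gen: "inj swap_gen"
  by (metis injI swap_swap_gen)

lemma swap_swap_image [simp]: "swap_gen ` swap_gen ` S = S"
  by (simp add: image_image)

lemma swap_image_iff: "g \<in> swap_gen ` S \<longleftrightarrow> swap_gen g \<in> S"
  by (metis image_iff swap_swap_gen)

definition sharp_sign :: "gen set \<Rightarrow> complex" where
  "sharp_sign S = (if EtaS Alice \<in> S \<and> Eta Alice \<notin> S then -1 else 1) *
     (if EtaS Bob \<in> S \<and> Eta Bob \<notin> S then -1 else 1)"

lemmas gen_order_iff = less_eq_gen_def less_gen_def

lemma gsign_UNIV:
  "gsign S T = (\<Prod>i\<in>UNIV. \<Prod>j\<in>UNIV. if i \<in> S \<and> j \<in> T \<and> j < i then -1 else 1)"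
proof -
  have "gsign S T = (\<Prod>i\<in>S. \<Prod>j\<in>UNIV. if i \<in> S \<and> j \<in> T \<and> j < i then -1 else 1)"
    unfolding gsign_def by (intro prod.cong refl prod.mono_neutral_cong_left) auto
  also have "\<dots> = (\<Prod>i\<in>UNIV. \<Prod>j\<in>UNIV. if i \<in> S \<and> j \<in> T \<and> j < i then -1 else 1)"
    by (rule prod.mono_neutral_left) auto
  finally show ?thesis .
qed

lemma cst_mult_cst: "cst a * cst b = cst (a * b)"
  by (rule grassmann_eqI) simp

lemma cst_commute: "x * cst a = cst a * x"
  by (rule grassmann_eqI) simp

lemma cst_mult_cst_left: "cst a * (cst b * x) = cst (a * b) * x"
  by (simp add: cst_mult_cst flip: mult.assoc)

lemma cst_left_commute: "x * (cst a * y) = cst a * (x * y)"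
  by (metis cst_commute mult.assoc)

lemma one_gmono: "1 = gmono {}"
  by (rule grassmann_eqI) simp

lemma cst_minus: "cst (- a) = - cst a" "cst 1 = 1"
  by (rule grassmann_eqI, simp)+

lemma sharp_gmono_eq: "sharp (gmono S) = cst (sharp_sign S) * gmono (swap_gen ` S)"
proof -
  define a b c d where abcd: "a \<longleftrightarrow> Eta Alice \<in> S" "b \<longleftrightarrow> EtaS Alice \<in> S"
    "c \<longleftrightarrow> Eta Bob \<in> S" "d \<longleftrightarrow> EtaS Bob \<in> S"
  have S: "S = (if a then {Eta Alice} else {}) \<union> (if b then {EtaS Alice} else {}) \<union>
    (if c then {Eta Bob} else {}) \<union> (if d then {EtaS Bob} else {})" (is "S = ?S")
  proof (rule set_eqI)
    fix g
    show "g \<in> S \<longleftrightarrow> g \<in> ?S"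
      by (cases g rule: gen_index.cases) (simp_all add: abcd)
  qed
  show ?thesis
    unfolding sharp_gmono S
    by (cases a; cases b; cases c; cases d)
       (simp_all add: sharp_sign_def gvar_def gmono_mult gsign_def gen_order_iff
         cst_mult_cst_left cst_left_commute cst_minus insert_commute flip: one_gmono)
qed

lemma coeff_sharp:
  "coeff (sharp x) S = sharp_sign (swap_gen ` S) * cnj (coeff x (swap_gen ` S))"
proof -
  let ?V = "swap_gen ` S"
  have "coeff (sharp x) S = (\<Sum>V\<in>UNIV. cnj (coeff x V) * (sharp_sign V * coeff (gmono (swap_gen ` V)) S))"
    by (subst sharp_def) (simp only: coeff_sum coeff_cst_mult sharp_gmono [symmetric] sharp_gmono_eq)
  also have "\<dots> = (\<Sum>V\<in>{?V}. cnj (coeff x V) * (sharp_sign V * coeff (gmono (swap_gen ` V)) S))"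
  proof (rule sum.mono_neutral_right; (intro ballI)?)
    fix V assume "V \<in> UNIV - {?V}"
    moreover have "V = ?V" if "S = swap_gen ` V"
      unfolding that swap_swap_image ..
    ultimately show "cnj (coeff x V) * (sharp_sign V * coeff (gmono (swap_gen ` V)) S) = 0"
      by auto
  qed simp_all
  finally show ?thesis
    by simp
qed

lemma gsign_explicit:
  "gsign S T =
    (if EtaS Alice \<in> S \<and> Eta Alice \<in> T then -1 else 1) *
    (if Eta Bob \<in> S \<and> Eta Alice \<in> T then -1 else 1) *
    (if Eta Bob \<in> S \<and> EtaS Alice \<in> T then -1 else 1) *
    (if EtaS Bob \<in> S \<and> Eta Alice \<in> T then -1 else 1) *
    (if EtaS Bob \<in> S \<and> EtaS Alice \<in> T then -1 else 1) *
    (if EtaS Bob \<in> S \<and> Eta Bob \<in> T then -1 else 1)"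
  unfolding gsign_UNIV UNIV_gen by (simp add: gen_order_iff mult.assoc split del: if_split)

lemma cnj_gsign: "cnj (gsign S T) = gsign S T"
  by (simp add: gsign_def if_distrib [of cnj] cong: if_cong)

lemma sharp_sign_mult:
  assumes "S \<inter> T = {}"
  shows "sharp_sign (S \<union> T) * gsign S T =
    gsign (swap_gen ` S) (swap_gen ` T) * sharp_sign S * sharp_sign T"
proof -
  have eqs: "swap_gen ` S = {g. swap_gen g \<in> S}" "swap_gen ` T = {g. swap_gen g \<in> T}"
    by (auto simp: swap_image_iff)
  have *: "(Eta Alice \<in> S \<and> Eta Alice \<in> T) = False" "(EtaS Alice \<in> S \<and> EtaS Alice \<in> T) = False"
    "(Eta Bob \<in> S \<and> Eta Bob \<in> T) = False" "(EtaS Bob \<in> S \<and> EtaS Bob \<in> T) = False"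
    using assms by auto
  have sgn: "(if a then -1 else 1) * (if b then -1 else 1) = (if a \<noteq> b then -1 else (1 :: complex))"
    for a b
    by simp
  show ?thesis
    unfolding sharp_sign_def gsign_explicit eqs swap_gen.simps Un_iff mem_Collect_eq sgn
    using * by (intro if_cong refl) argo
qed

lemma sharp_mult: "sharp (x * y) = sharp x * sharp y"
proof (rule grassmann_eqI)
  fix S
  let ?w = "\<lambda>S. swap_gen ` S"
  have "coeff (sharp (x * y)) S = (\<Sum>T\<in>Pow (?w S). sharp_sign (?w S) * gsign T (?w S - T) *
      (cnj (coeff x T) * cnj (coeff y (?w S - T))))"
    by (simp add: coeff_sharp coeff_mult sum_distrib_left mult.assoc cnj_gsign)
  also have "\<dots> = (\<Sum>T\<in>Pow S. gsign T (S - T) * coeff (sharp x) T * coeff (sharp y) (S - T))"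
  proof (rule sum.reindex_bij_witness [where i = ?w and j = ?w])
    fix T assume T: "T \<in> Pow (?w S)"
    have d: "?w (S - ?w T) = ?w S - T"
      using image_set_diff [OF inj_swap_gen, of S "?w T"] by simp
    have "sharp_sign (?w S) * gsign T (?w S - T) =
        gsign (?w T) (?w (?w S - T)) * sharp_sign T * sharp_sign (?w S - T)"
      using sharp_sign_mult [of T "?w S - T"] T by (simp add: Un_absorb1)
    moreover have "?w (?w S - T) = S - ?w T"
      using image_set_diff [OF inj_swap_gen, of "?w S" T] by simp
    ultimately show "gsign (?w T) (S - ?w T) * coeff (sharp x) (?w T) *
        coeff (sharp y) (S - ?w T) = sharp_sign (?w S) * gsign T (?w S - T) *
        (cnj (coeff x T) * cnj (coeff y (?w S - T)))"
      by (simp add: coeff_sharp d mult_ac)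
  next
    show "?w T \<in> Pow S" if "T \<in> Pow (?w S)" for T
      using image_mono [of T "?w S" swap_gen] that by simp
  qed auto
  finally show "coeff (sharp (x * y)) S = coeff (sharp x * sharp y) S"
    by (simp add: coeff_mult)
qed

text \<open>The exponential series of an element without constant term stops before the fifth power.\<close>

definition gexp :: "grassmann \<Rightarrow> grassmann" where
  "gexp x = (\<Sum>k\<le>4. rcst (1 / fact k) * x ^ k)"

text \<open>\<open>\<integral> d\<eta>\<^sub>A d\<eta>\<^sub>A\<^sup># d\<eta>\<^sub>B d\<eta>\<^sub>B\<^sup>#\<close> extracts the coefficient of
  \<open>(-\<eta>\<^sub>A \<eta>\<^sub>A\<^sup>#) (-\<eta>\<^sub>B \<eta>\<^sub>B\<^sup>#) = \<eta>\<^sub>A \<eta>\<^sub>A\<^sup># \<eta>\<^sub>B \<eta>\<^sub>B\<^sup>#\<close>.\<close>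

definition berezin :: "grassmann \<Rightarrow> complex" where
  "berezin x = coeff x UNIV"

definition rogers :: "grassmann \<Rightarrow> complex" where
  "rogers x =
    berezin (gexp (- (eta Alice * etaS Alice)) * gexp (- (eta Bob * etaS Bob)) * x)"

lemma eta_mult_etaS: "eta X * etaS X = gmono {Eta X, EtaS X}"
  by (rule grassmann_eqI) (cases X; simp add: gvar_def gmono_mult gsign_def gen_order_iff insert_commute)

lemma gexp_eta: "gexp (- (eta X * etaS X)) = 1 - gmono {Eta X, EtaS X}"
proof -
  have "{..4::nat} = {0, 1, 2, 3, 4}"
    by auto
  then show ?thesis
    by (simp add: gexp_def eta_mult_etaS gmono_mult numeral_eq_Suc cst_minus)
qed

lemma rogers_eq:
  "rogers x = coeff x {} - coeff x {Eta Alice, EtaS Alice} - coeff x {Eta Bob, EtaS Bob}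
    + coeff x UNIV"
proof -
  have top: "coeff (gmono S * x) UNIV = gsign S (- S) * coeff x (- S)" for S
  proof -
    have "coeff (gmono S * x) UNIV =
        (\<Sum>T\<in>UNIV. if T = S then gsign T (- T) * coeff x (- T) else 0)"
      unfolding coeff_mult by (rule sum.cong) (auto simp: Compl_eq_Diff_UNIV)
    then show ?thesis
      by simp
  qed
  have compl: "- {Eta Alice, EtaS Alice} = {Eta Bob, EtaS Bob}"
    "- {Eta Bob, EtaS Bob} = {Eta Alice, EtaS Alice}"
    using UNIV_gen by auto
  have prod: "gmono {Eta Alice, EtaS Alice} * gmono {Eta Bob, EtaS Bob} = gmono UNIV"
    by (simp add: gmono_mult gsign_def gen_order_iff cst_minus UNIV_gen insert_commute)
  show ?thesis
    by (simp add: rogers_def berezin_def gexp_eta algebra_simps prod)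
       (simp add: top compl gsign_def gen_order_iff flip: mult.assoc)
qed

datatype ket = Ket0 | Ket1 | KetBullet

lemma UNIV_ket: "UNIV = {Ket0, Ket1, KetBullet}"
  using ket.exhaust by auto

instance ket :: finite
  by standard (simp add: UNIV_ket)

fun ket_parity :: "ket \<Rightarrow> nat" where
  "ket_parity Ket0 = 0"
| "ket_parity Ket1 = 0"
| "ket_parity KetBullet = 1"

text \<open>Sign rule: \<open>|m\<rangle> x = move_left m x |m\<rangle>\<close>.\<close>

definition move_left :: "ket \<Rightarrow> grassmann \<Rightarrow> grassmann" where
  "move_left m x = (if odd (ket_parity m) then ginvol x else x)"

text \<open>A supermatrix \<open>M\<close> (row, column) acts on right coordinates:
  \<open>M |n\<rangle> = (\<Sum>m. |m\<rangle> M m n)\<close>.\<close>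

type_synonym supermatrix = "ket \<Rightarrow> ket \<Rightarrow> grassmann"

definition smat_mult :: "supermatrix \<Rightarrow> supermatrix \<Rightarrow> supermatrix" where
  "smat_mult M N m n = (\<Sum>k\<in>UNIV. M m k * N k n)"

text \<open>\<open>left_coord M n m\<close> is the coefficient, written on the left, of \<open>|m\<rangle>\<close> in \<open>M |n\<rangle>\<close>.\<close>

definition left_coord :: "supermatrix \<Rightarrow> ket \<Rightarrow> ket \<Rightarrow> grassmann" where
  "left_coord M n m = move_left m (M m n)"

fun U_mat :: "complex \<Rightarrow> complex \<Rightarrow> supermatrix" where
  "U_mat a b Ket0 Ket0 = cst a"
| "U_mat a b Ket1 Ket0 = cst b"
| "U_mat a b Ket0 Ket1 = cst (- cnj b)"
| "U_mat a b Ket1 Ket1 = cst (cnj a)"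
| "U_mat a b KetBullet KetBullet = 1"
| "U_mat a b _ _ = 0"

text \<open>\<open>S_mat p X\<close> is \<open>S(2p\<eta>\<^sub>X)\<close>.\<close>

fun S_mat :: "real \<Rightarrow> party \<Rightarrow> supermatrix" where
  "S_mat p X Ket0 Ket0 = 1 + rcst (p\<^sup>2 / 2) * eta X * etaS X"
| "S_mat p X Ket0 Ket1 = 0"
| "S_mat p X Ket0 KetBullet = - rcst p * etaS X"
| "S_mat p X Ket1 Ket0 = 0"
| "S_mat p X Ket1 Ket1 = 1 + rcst (p\<^sup>2 / 2) * eta X * etaS X"
| "S_mat p X Ket1 KetBullet = - rcst p * eta X"
| "S_mat p X KetBullet Ket0 = rcst p * eta X"
| "S_mat p X KetBullet Ket1 = - rcst p * etaS X"
| "S_mat p X KetBullet KetBullet = 1 - rcst (p\<^sup>2) * eta X * etaS X"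

lemma left_coord_S_mat:
  "left_coord (S_mat p X) Ket0 Ket0 = 1 + rcst (p\<^sup>2 / 2) * eta X * etaS X"
  "left_coord (S_mat p X) Ket0 Ket1 = 0"
  "left_coord (S_mat p X) Ket0 KetBullet = - rcst p * eta X"
  "left_coord (S_mat p X) Ket1 Ket0 = 0"
  "left_coord (S_mat p X) Ket1 Ket1 = 1 + rcst (p\<^sup>2 / 2) * eta X * etaS X"
  "left_coord (S_mat p X) Ket1 KetBullet = rcst p * etaS X"
  "left_coord (S_mat p X) KetBullet Ket0 = - rcst p * etaS X"
  "left_coord (S_mat p X) KetBullet Ket1 = - rcst p * eta X"
  "left_coord (S_mat p X) KetBullet KetBullet = 1 - rcst (p\<^sup>2) * eta X * etaS X"
  unfolding left_coord_def
  by (rule grassmann_eqI;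
      simp add: move_left_def ginvol_def mult.assoc eta_mult_etaS; simp add: gvar_def)+

definition Z_mat :: "real \<Rightarrow> party \<Rightarrow> complex \<Rightarrow> complex \<Rightarrow> supermatrix" where
  "Z_mat r X a b = smat_mult (S_mat r X) (U_mat a b)"

text \<open>A two-party state is given by the left coefficients \<open>c m n\<close> of
  \<open>|m n\<rangle> = |m\<rangle>\<^sub>A |n\<rangle>\<^sub>B\<close>.\<close>

type_synonym state2 = "ket \<Rightarrow> ket \<Rightarrow> grassmann"

text \<open>For even \<open>Z\<close> and \<open>W\<close>, \<open>(Z \<otimes> W) (c |m n\<rangle>) = c (Z |m\<rangle>) (W |n\<rangle>)\<close>; with
  \<open>Z |m\<rangle> = (\<Sum>k. a\<^sub>k |k\<rangle>)\<close> and \<open>W |n\<rangle> = (\<Sum>l. b\<^sub>l |l\<rangle>)\<close>, the coefficient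
  \<open>b\<^sub>l\<close> has to pass \<open>|k\<rangle>\<close>.\<close>

definition local_action :: "supermatrix \<Rightarrow> supermatrix \<Rightarrow> state2 \<Rightarrow> state2" where
  "local_action Z W c k l =
    (\<Sum>m\<in>UNIV. \<Sum>n\<in>UNIV. c m n * left_coord Z m k * move_left k (left_coord W n l))"

fun Upsilon :: "real \<Rightarrow> real \<Rightarrow> state2" where
  "Upsilon pA pB Ket0 Ket0 =
    (1 + rcst (pA\<^sup>2 / 2) * eta Alice * etaS Alice) * (1 + rcst (pB\<^sup>2 / 2) * eta Bob * etaS Bob)
      * rcst (1 / sqrt 2)"
| "Upsilon pA pB Ket1 Ket1 =
    (1 + rcst (pA\<^sup>2 / 2) * eta Alice * etaS Alice) * (1 + rcst (pB\<^sup>2 / 2) * eta Bob * etaS Bob)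
      * rcst (1 / sqrt 2)"
| "Upsilon pA pB Ket1 KetBullet =
    rcst pB * eta Bob * (1 + rcst (pA\<^sup>2 / 2) * eta Alice * etaS Alice)"
| "Upsilon pA pB KetBullet Ket1 =
    rcst pA * eta Alice * (1 + rcst (pB\<^sup>2 / 2) * eta Bob * etaS Bob)"
| "Upsilon pA pB KetBullet KetBullet = - rcst (pA * pB) * eta Alice * eta Bob"
| "Upsilon pA pB _ _ = 0"

definition grassmann_prob :: "state2 \<Rightarrow> ket \<Rightarrow> ket \<Rightarrow> grassmann" where
  "grassmann_prob c m n =
    (-1) ^ (ket_parity m + ket_parity n + ket_parity m * ket_parity n) * (c m n * sharp (c m n))"

definition prob :: "state2 \<Rightarrow> ket \<Rightarrow> ket \<Rightarrow> complex" where
  "prob c m n = rogers (grassmann_prob c m n)"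

text \<open>Outcomes \<open>1\<close> and \<open>\<bullet>\<close> are both reported as bit 1; the first two arguments of \<open>P\<close> are
  the inputs.\<close>

definition chsh_win :: "(nat \<Rightarrow> nat \<Rightarrow> ket \<Rightarrow> ket \<Rightarrow> real) \<Rightarrow> real" where
  "chsh_win P = 1 / 4 *
    ((\<Sum>(i, j)\<in>{(0, 0), (0, 1), (1, 0)}.
        P i j Ket0 Ket0 + P i j Ket1 Ket1 + P i j Ket1 KetBullet + P i j KetBullet Ket1
        + P i j KetBullet KetBullet)
      + P 1 1 Ket0 Ket1 + P 1 1 Ket1 Ket0 + P 1 1 Ket0 KetBullet + P 1 1 KetBullet Ket0)"

end

theory Submission
  imports Defs
begin

text \<open>Only Alice needs Grassmann parameters: with \<open>p\<^sub>B = s\<^sub>j = 0\<close> every amplitude lies in the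
  four-dimensional subalgebra generated by \<open>\<eta>\<^sub>A, \<eta>\<^sub>A\<^sup>#\<close>. With real rotations
  and \<open>r = \<surd>2 q\<close> the nine probabilities are polynomials with rational coefficients. For
  \<open>p\<^sub>A = 1/2\<close>, \<open>q\<^sub>1 = - q\<^sub>0\<close>, Alice's angles \<open>-a, a\<close> and Bob's angles \<open>0, -\<pi>/4\<close> the winning
  probability is
  \<open>(k cos\<^sup>2 a + k (1 + sin 2a) / 2 + 2 q\<^sup>2 + q (cos a - sin a) + 3/8) / 2\<close> with
  \<open>q = q\<^sub>0\<close> and \<open>k = 3/4 - 2 q\<^sup>2\<close>; all probabilities are nonnegative when
  \<open>(cos a - sin a) k \<ge> 2 q\<close>. A rational point close to the constrained maximum (about \<open>0.86467\<close>)
  is \<open>q = 15/61\<close>, \<open>cos a = 99/101\<close>, \<open>sin a = 20/101\<close>, with value about \<open>0.864653\<close>.\<close>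

text \<open>Fixing coordinates in Alice's subalgebra turns products, \<open>sharp\<close> and
  \<open>rogers\<close> into formulas in four complex numbers, with no sums over sets of
  generators.\<close>

definition galice :: "complex \<Rightarrow> complex \<Rightarrow> complex \<Rightarrow> complex \<Rightarrow> grassmann" where
  "galice w x y z = cst w + cst x * eta Alice + cst y * etaS Alice + cst z * (eta Alice * etaS Alice)"

lemma coeff_galice:
  "coeff (galice w x y z) S = (if S = {} then w else 0) + (if S = {Eta Alice} then x else 0)
    + (if S = {EtaS Alice} then y else 0) + (if S = {Eta Alice, EtaS Alice} then z else 0)"
  by (simp add: galice_def eta_mult_etaS) (simp add: gvar_def)

lemma galice_add:
  "galice w x y z + galice w' x' y' z' = galice (w + w') (x + x') (y + y') (z + z')"
  by (rule grassmann_eqI) (simp add: coeff_galice)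

lemma galice_diff:
  "galice w x y z - galice w' x' y' z' = galice (w - w') (x - x') (y - y') (z - z')"
  by (rule grassmann_eqI) (simp add: coeff_galice)

lemma galice_uminus: "- galice w x y z = galice (- w) (- x) (- y) (- z)"
  by (rule grassmann_eqI) (simp add: coeff_galice)

lemma galice_mult: "galice w x y z * galice w' x' y' z' =
  galice (w * w') (w * x' + x * w') (w * y' + y * w') (w * z' + x * y' - y * x' + z * w')"
proof -
  have 1: "etaS Alice * eta Alice = - (eta Alice * etaS Alice)"
    by (rule gvar_anticommute)
  \<comment> \<open>The trailing factor \<open>v\<close> lets these rules fire inside the
    right-nested products that \<open>mult.assoc\<close> produces.\<close>
  have 2: "eta Alice * (eta Alice * v) = 0" "etaS Alice * (etaS Alice * v) = 0"
    "etaS Alice * (eta Alice * v) = - (eta Alice * (etaS Alice * v))" for v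
    using gvar_square gvar_anticommute[of "EtaS Alice" "Eta Alice"]
    by (simp_all flip: mult.assoc)
  show ?thesis
    by (rule grassmann_eqI)
      (simp add: galice_def ring_distribs mult.assoc gvar_square 1 2
        cst_commute [of "eta Alice"] cst_commute [of "etaS Alice"]
        cst_left_commute [of "eta Alice"] cst_left_commute [of "etaS Alice"])
qed

lemma galice_ginvol: "ginvol (galice w x y z) = galice w (- x) (- y) z"
  by (rule grassmann_eqI) (simp add: ginvol_def coeff_galice)

text \<open>The top monomial is fixed up to conjugating its coefficient: \<open>sharp\<close> sends
  it to \<open>etaS Alice * (- eta Alice)\<close>, which is \<open>eta Alice * etaS Alice\<close>
  again.\<close>

lemma galice_sharp: "sharp (galice w x y z) = galice (cnj w) (- cnj y) (cnj x) (cnj z)"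
proof -
  have "sharp (cst c) = cst (cnj c)" for c
    using sharp_cst_mult[of c 1] sharp_gmono[of "{}"] by (simp flip: one_gmono)
  then show ?thesis
    by (intro grassmann_eqI)
      (simp add: galice_def sharp_add sharp_mult sharp_gvar
        gvar_anticommute [of "EtaS Alice" "Eta Alice"])
qed

text \<open>The terms of \<open>rogers_eq\<close> at Bob's pair and at \<open>UNIV\<close> vanish on
  Alice's subalgebra.\<close>

lemma galice_rogers: "rogers (galice w x y z) = w - z"
proof -
  have "UNIV \<noteq> {Eta Alice, EtaS Alice}"
    by (metis UNIV_I insert_iff empty_iff gen.inject(1) gen.distinct(1) party.distinct(1))
  moreover have "UNIV \<noteq> {g}" for g :: gen
    by (metis UNIV_I singletonD gen.distinct(1))
  ultimately show ?thesis
    by (simp add: rogers_eq coeff_galice doubleton_eq_iff)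
qed

lemma galice_eqs:
  "0 = galice 0 0 0 0" "1 = galice 1 0 0 0" "cst c = galice c 0 0 0"
  "eta Alice = galice 0 1 0 0" "etaS Alice = galice 0 0 1 0"
  by (rule grassmann_eqI, simp add: coeff_galice; simp add: gvar_def)+

lemma cst_0 [simp]: "cst 0 = 0"
  by (rule grassmann_eqI) simp

lemma Z_mat_0: "Z_mat 0 X a b = U_mat a b"
proof (intro ext)
  show "Z_mat 0 X a b m n = U_mat a b m n" for m n
    by (cases m; cases n) (simp_all add: Z_mat_def smat_mult_def UNIV_ket)
qed

lemma galice_mult_cst:
  "galice w x y z * cst c = galice (c * w) (c * x) (c * y) (c * z)"
  by (rule grassmann_eqI) (simp add: coeff_galice)

lemma left_coord_Z_mat:
  "left_coord (Z_mat r Alice a b) Ket0 Ket0 = galice a 0 0 (r\<^sup>2 / 2 * a)"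
  "left_coord (Z_mat r Alice a b) Ket0 Ket1 = galice b 0 0 (r\<^sup>2 / 2 * b)"
  "left_coord (Z_mat r Alice a b) Ket0 KetBullet = galice 0 (- r * a) (r * b) 0"
  "left_coord (Z_mat r Alice a b) Ket1 Ket0 = galice (- cnj b) 0 0 (- (r\<^sup>2 / 2 * cnj b))"
  "left_coord (Z_mat r Alice a b) Ket1 Ket1 = galice (cnj a) 0 0 (r\<^sup>2 / 2 * cnj a)"
  "left_coord (Z_mat r Alice a b) Ket1 KetBullet = galice 0 (r * cnj b) (r * cnj a) 0"
  "left_coord (Z_mat r Alice a b) KetBullet Ket0 = galice 0 0 (- r) 0"
  "left_coord (Z_mat r Alice a b) KetBullet Ket1 = galice 0 (- r) 0 0"
  "left_coord (Z_mat r Alice a b) KetBullet KetBullet = galice 1 0 0 (- (r\<^sup>2))"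
  by (simp_all add: left_coord_def move_left_def Z_mat_def smat_mult_def UNIV_ket galice_eqs
     galice_add galice_diff galice_uminus galice_mult galice_ginvol)

text \<open>Entries of \<open>U_mat\<close> are constants, hence even, so Bob's coefficients pass
  Alice's ket without a sign.\<close>

lemma move_left_U_mat:
  "move_left k (left_coord (U_mat a b) m n) = left_coord (U_mat a b) m n"
  by (rule grassmann_eqI, cases m; cases n) (simp_all add: move_left_def left_coord_def ginvol_def)

lemma Upsilon_0:
  "Upsilon p 0 m n = (if m = n \<and> m \<noteq> KetBullet then galice (1 / sqrt 2) 0 0 (p\<^sup>2 / 2 / sqrt 2)
     else if m = KetBullet \<and> n = Ket1 then galice 0 p 0 0 else 0)"
  by (cases m; cases n; simp add: cst_minus;
      simp add: galice_eqs galice_add galice_diff galice_uminus galice_mult)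

text \<open>For Alice's outcomes 0 and 1 the amplitude has the form \<open>galice w 0 0 z\<close>
  and contributes \<open>w\<^sup>2 - 2 * w * z\<close>; for her bullet it is
  \<open>galice 0 x y 0\<close> and contributes \<open>x\<^sup>2 + y\<^sup>2\<close>. Outcome 1 has
  no cross term because there the odd part of the state meets a second factor
  \<open>eta Alice\<close>.\<close>

fun alice_prob :: "real \<Rightarrow> real \<Rightarrow> real \<Rightarrow> real \<Rightarrow> real \<Rightarrow> real \<Rightarrow> ket \<Rightarrow> ket \<Rightarrow> real" where
  "alice_prob p q a b g d Ket0 Ket0 =
    (1 / 2 - p\<^sup>2 / 2 - q\<^sup>2) * (a * g + b * d)\<^sup>2 - 2 * p * q * (a * g + b * d) * d"
| "alice_prob p q a b g d Ket0 Ket1 =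
    (1 / 2 - p\<^sup>2 / 2 - q\<^sup>2) * (a * d - b * g)\<^sup>2 + 2 * p * q * (a * d - b * g) * g"
| "alice_prob p q a b g d Ket1 Ket0 = (1 / 2 - p\<^sup>2 / 2 - q\<^sup>2) * (b * g - a * d)\<^sup>2"
| "alice_prob p q a b g d Ket1 Ket1 = (1 / 2 - p\<^sup>2 / 2 - q\<^sup>2) * (a * g + b * d)\<^sup>2"
| "alice_prob p q a b g d KetBullet Ket0 =
    (p * d + q * (a * g + b * d))\<^sup>2 + q\<^sup>2 * (b * g - a * d)\<^sup>2"
| "alice_prob p q a b g d KetBullet Ket1 =
    (p * g - q * (a * d - b * g))\<^sup>2 + q\<^sup>2 * (a * g + b * d)\<^sup>2"
| "alice_prob p q a b g d _ KetBullet = 0"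

lemma prob_Alice:
  fixes p q a b g d :: real
  shows "prob (local_action (Z_mat (sqrt 2 * q) Alice a b) (Z_mat 0 Bob g d) (Upsilon p 0)) m n
    = of_real (alice_prob p q a b g d m n)"
proof -
  have 2: "complex_of_real (sqrt 2) * complex_of_real (sqrt 2) = 2"
    by (simp flip: of_real_mult)
  have 3: "complex_of_real (sqrt 2) * (complex_of_real (sqrt 2) * z) = 2 * z" for z
    using 2 by (simp flip: mult.assoc)
  \<comment> \<open>Clearing \<open>sqrt 2\<close> from denominators lets 2 and 3 remove it from all
    products of amplitudes.\<close>
  have 4: "z / complex_of_real (sqrt 2) = z * complex_of_real (sqrt 2) / 2" for z
    using 2 by (simp add: field_simps)
  have 5: "z / (complex_of_real (sqrt 2) * 2) = z * complex_of_real (sqrt 2) / 4" for z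
    using 2 by (simp add: field_simps)
  have U: "left_coord (U_mat a b) Ket0 Ket0 = cst a"
    "left_coord (U_mat a b) Ket0 Ket1 = cst b" "left_coord (U_mat a b) Ket0 KetBullet = 0"
    "left_coord (U_mat a b) Ket1 Ket0 = - cst (cnj b)"
    "left_coord (U_mat a b) Ket1 Ket1 = cst (cnj a)" "left_coord (U_mat a b) Ket1 KetBullet = 0"
    "left_coord (U_mat a b) KetBullet Ket0 = 0" "left_coord (U_mat a b) KetBullet Ket1 = 0"
    for a b
    by (rule grassmann_eqI, simp add: left_coord_def move_left_def cst_minus ginvol_def)+
  note * = prob_def grassmann_prob_def local_action_def UNIV_ket Z_mat_0 move_left_U_mat Upsilon_0
    left_coord_Z_mat U
  show ?thesis
    \<comment> \<open>Bob's bullet has amplitude 0; \<open>rogers_eq [of 0]\<close> settles those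
      three cases.\<close>
    by (cases m; cases n; simp add: * rogers_eq [of 0])
      (simp_all add: cst_minus galice_add galice_diff galice_uminus galice_mult galice_mult_cst
        galice_sharp galice_rogers algebra_simps power2_eq_square 2 3 4 5)
qed

theorem theorem20:
  shows "\<exists>(pA :: real) (pB :: real) (r :: nat \<Rightarrow> real) (s :: nat \<Rightarrow> real)
      (\<alpha> :: nat \<Rightarrow> complex) (\<beta> :: nat \<Rightarrow> complex)
      (\<gamma> :: nat \<Rightarrow> complex) (\<delta> :: nat \<Rightarrow> complex).
    let P = (\<lambda>i j. prob (local_action
               (Z_mat (r i) Alice (\<alpha> i) (\<beta> i)) (Z_mat (s j) Bob (\<gamma> j) (\<delta> j))
               (Upsilon pA pB)));
        p_win = chsh_win (\<lambda>i j m n. Re (P i j m n))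
    in (\<forall>i\<in>{0, 1}. (cmod (\<alpha> i))\<^sup>2 + (cmod (\<beta> i))\<^sup>2 = 1)
     \<and> (\<forall>j\<in>{0, 1}. (cmod (\<gamma> j))\<^sup>2 + (cmod (\<delta> j))\<^sup>2 = 1)
     \<and> (\<forall>i\<in>{0, 1}. \<bar>r i\<bar> \<le> 1 / 2) \<and> (\<forall>j\<in>{0, 1}. \<bar>s j\<bar> \<le> 1 / 2)
     \<and> \<bar>pA\<bar> \<le> 1 / 2 \<and> \<bar>pB\<bar> \<le> 1 / 2
     \<and> (\<forall>i\<in>{0, 1}. \<forall>j\<in>{0, 1}. \<forall>m n.
          P i j m n \<in> \<real> \<and> 0 \<le> Re (P i j m n) \<and> Re (P i j m n) \<le> 1)
     \<and> \<bar>p_win - 0.8647\<bar> \<le> 5 / 10 ^ 5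
     \<and> p_win > (cos (pi / 8))\<^sup>2"
proof -
  define v where "v = sqrt 2 / 2"
  define q where "q i = (if i = 0 then 15 / 61 else - 15 / 61 :: real)" for i :: nat
  define b where "b i = (if i = 0 then - 20 / 101 else 20 / 101 :: real)" for i :: nat
  define g where "g j = (if j = 0 then 1 else v)" for j :: nat
  define d where "d j = (if j = 0 then 0 else - v)" for j :: nat
  define R where "R i j = alice_prob (1 / 2) (q i) (99 / 101) (b i) (g j) (d j)" for i j
  \<comment> \<open>Every entry of \<open>alice_prob\<close> is homogeneous of degree two in Bob's
    pair \<open>g\<close>, \<open>d\<close>, so \<open>v\<close> occurs only through
    \<open>v * v\<close> and all probabilities are rational.\<close>
  have v: "v * v = 1 / 2" "v * (v * x) = x / 2" for x
    by (simp_all add: v_def field_simps flip: mult.assoc)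
  have vals: "R 0 0 m n = alice_prob (1 / 2) (15 / 61) (99 / 101) (- 20 / 101) 1 0 m n"
    "R 1 0 m n = alice_prob (1 / 2) (- 15 / 61) (99 / 101) (20 / 101) 1 0 m n"
    "R 0 1 m n = alice_prob (1 / 2) (15 / 61) (99 / 101) (- 20 / 101) v (- v) m n"
    "R 1 1 m n = alice_prob (1 / 2) (- 15 / 61) (99 / 101) (20 / 101) v (- v) m n" for m n
    by (simp_all add: R_def q_def b_def g_def d_def)
  \<comment> \<open>Nearly binding are outcome (0, 1) on inputs (0, 1) and outcome (0, 0) on inputs
    (1, 1), both equal to (c - s) ((c - s) k - 2 q) / 4 with c = cos a and s = sin a.\<close>
  have bounds: "0 \<le> R i j m n \<and> R i j m n \<le> 1" if "i \<in> {0, 1}" "j \<in> {0, 1}" for i j m n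
    using that by (cases m; cases n; elim insertE emptyE; simp only: vals;
        simp add: power2_eq_square algebra_simps v)
  have win: "\<bar>chsh_win R - 0.8647\<bar> \<le> 5 / 10 ^ 5 \<and> 0.8646 \<le> chsh_win R"
    unfolding chsh_win_def
    by (simp add: vals del: One_nat_def) (simp add: power2_eq_square algebra_simps v)
  have "(cos (pi / 8))\<^sup>2 = (1 + cos (pi / 4)) / 2"
    using cos_double_cos [of "pi / 8"] by simp
  also have "\<dots> = 1 / 2 + v / 2"
    by (simp add: cos_45 v_def)
  \<comment> \<open>This crude bound puts Tsirelson's value below 0.86, hence below 0.8646.\<close>
  also have "v \<le> 0.72"
    by (rule power2_le_imp_le) (simp_all add: power2_eq_square v)
  finally have tsirelson: "(cos (pi / 8))\<^sup>2 < chsh_win R"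
    using win by simp
  have r: "\<bar>sqrt 2 * q i\<bar> \<le> 1 / 2" for i
  proof -
    have "\<bar>sqrt 2 * q i\<bar>\<^sup>2 \<le> (1 / 2)\<^sup>2"
      by (simp add: q_def power_mult_distrib power2_eq_square)
    then show ?thesis
      by (rule power2_le_imp_le) simp
  qed
  have P: "prob (local_action
      (Z_mat (sqrt 2 * q i) Alice (complex_of_real (99 / 101)) (complex_of_real (b i)))
      (Z_mat 0 Bob (complex_of_real (g j)) (complex_of_real (d j))) (Upsilon (1 / 2) 0)) m n
    = complex_of_real (R i j m n)" for i j m n
    unfolding R_def by (rule prob_Alice)
  have normalized: "(cmod (complex_of_real (99 / 101)))\<^sup>2 + (cmod (complex_of_real (b i)))\<^sup>2 = 1"
    "(cmod (complex_of_real (g j)))\<^sup>2 + (cmod (complex_of_real (d j)))\<^sup>2 = 1" for i j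
    \<comment> \<open>Alice's pair is normalized by the Pythagorean triple 20, 99, 101.\<close>
    by (simp_all only: norm_of_real power2_abs)
      (simp_all add: b_def g_def d_def power2_eq_square v)
  show ?thesis
    unfolding Let_def
    by (rule exI [of _ "1 / 2"], rule exI [of _ 0], rule exI [of _ "\<lambda>i. sqrt 2 * q i"],
        rule exI [of _ "\<lambda>_. 0"], rule exI [of _ "\<lambda>_. complex_of_real (99 / 101)"],
        rule exI [of _ "\<lambda>i. complex_of_real (b i)"], rule exI [of _ "\<lambda>j. complex_of_real (g j)"],
        rule exI [of _ "\<lambda>j. complex_of_real (d j)"], unfold P Re_complex_of_real,
        intro conjI ballI allI)
      ((rule normalized r bounds [THEN conjunct1] bounds [THEN conjunct2] Reals_of_real
        win [THEN conjunct1] tsirelson; assumption) | simp)+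
qed

end
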